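(* For any $L>0$, $\rho\ge\frac{1}{2L}$, and any choice of stepsizes $\gamma_1,\gamma_2>0$ there exists a $\rho$-negative comonotone $L$-Lipschitz operator $F$ such that the Extragradient method with stepsizes $\gamma_1,\gamma_2$ does not necessarily converge when solving the problem of finding $x^*$ with $F(x^* )=0$. In particular, for $\gamma_1>\frac1L$ it is sufficient to take $F(x)=Lx$, and for $0<\gamma_1\le\frac1L$ one can take $F(x)=LAx$, where $x\in\mathbb{R}^2$ and $$A=\begin{pmatrix}\cos\theta&-\sin\theta\\ \sin\theta&\cos\theta\end{pmatrix},\qquad\theta=\frac{2\pi}{3}.$$
   Context: For a single-valued operator $F:\mathbb{R}^d\to\mathbb{R}^d$: $F$ is $L$-Lipschitz if $\|F(x)-F(y)\|\le L\|x-y\|$ for all $x,y$; $F$ is $\rho$-negative comonotone if $\langle F(x)-F(y),x-y\rangle\ge-\rho\|F(x)-F(y)\|^2$ for all $x,y$. The Extragradient method with stepsizes $\gamma_1,\gamma_2$ generates from $x^0$: $\widetilde x^k=x^k-\gamma_1F(x^k)$, $x^{k+1}=x^k-\gamma_2F(\widetilde x^k)$ for all $k\ge0$. "Does not necessarily converge" means that there is a starting point $x^0$ from which the sequence $(x^k)$ does not converge to a solution. *)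

theory Defs
  imports "HOL-Analysis.Analysis"
begin

definition negative_comonotone :: "real \<Rightarrow> ('a::euclidean_space \<Rightarrow> 'a) \<Rightarrow> bool" where
  "negative_comonotone \<rho> F \<longleftrightarrow>
     (\<forall>x y. (F x - F y) \<bullet> (x - y) \<ge> - \<rho> * (norm (F x - F y))\<^sup>2)"

primrec extragradient ::
    "real \<Rightarrow> real \<Rightarrow> ('a::euclidean_space \<Rightarrow> 'a) \<Rightarrow> 'a \<Rightarrow> nat \<Rightarrow> 'a" where
  "extragradient \<gamma>\<^sub>1 \<gamma>\<^sub>2 F x0 0 = x0"
| "extragradient \<gamma>\<^sub>1 \<gamma>\<^sub>2 F x0 (Suc k) =
     (let x = extragradient \<gamma>\<^sub>1 \<gamma>\<^sub>2 F x0 k;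
          x' = x - \<gamma>\<^sub>1 *\<^sub>R F x
      in x - \<gamma>\<^sub>2 *\<^sub>R F x')"

text \<open>The method converges from a starting point if its iterates tend to some zero of
  the operator; which zero is reached may depend on the starting point. The predicate below
  is true for any operator without zeros, so existence of a zero has to be required
  separately where it matters.\<close>

definition extragradient_not_nec_convergent ::
    "real \<Rightarrow> real \<Rightarrow> ('a::euclidean_space \<Rightarrow> 'a) \<Rightarrow> bool" where
  "extragradient_not_nec_convergent \<gamma>\<^sub>1 \<gamma>\<^sub>2 F \<longleftrightarrow>
     (\<exists>x0. \<not> (\<exists>z. F z = 0 \<and> extragradient \<gamma>\<^sub>1 \<gamma>\<^sub>2 F x0 \<longlonglongrightarrow> z))"

definition rotation2 :: "real \<Rightarrow> real ^ 2 ^ 2" where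
  "rotation2 \<theta> = vector [vector [cos \<theta>, - sin \<theta>], vector [sin \<theta>, cos \<theta>]]"

definition eg_counterexample ::
    "real \<Rightarrow> real \<Rightarrow> real \<Rightarrow> real \<Rightarrow> ('a::euclidean_space \<Rightarrow> 'a) \<Rightarrow> bool" where
  "eg_counterexample L \<rho> \<gamma>\<^sub>1 \<gamma>\<^sub>2 F \<longleftrightarrow>
     L-lipschitz_on UNIV F \<and> negative_comonotone \<rho> F \<and> (\<exists>z. F z = 0) \<and>
     extragradient_not_nec_convergent \<gamma>\<^sub>1 \<gamma>\<^sub>2 F"

end

theory Submission
  imports Defs
begin

text \<open>Both counterexamples are linear maps that scale every norm by \<open>L\<close>, so they are
  \<open>L\<close>-Lipschitz and vanish only at the origin. For such an operator comonotonicity is a lower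
  bound on \<open>F x \<bullet> x\<close>, and the iterates stay away from the origin as soon as
  \<open>x \<bullet> F (x - \<gamma>\<^sub>1 *\<^sub>R F x) \<le> 0\<close> for all \<open>x\<close>: the update direction then never points
  towards the solution, so the distance to it cannot decrease. These two facts are combined in
  \<open>scaled_isometry_counterexample\<close>; it remains to compute inner products.

  For \<open>F x = L x\<close> with \<open>\<gamma>\<^sub>1 > 1 / L\<close> the extrapolation step overshoots the origin, so \<open>F\<close> at the
  extrapolated point is a nonpositive multiple of \<open>x\<close>.

  For \<open>F = L R\<close> with \<open>R\<close> the rotation by \<open>2 * pi / 3\<close>, both \<open>R x\<close> and \<open>R (R x)\<close> make an angle
  of \<open>2 * pi / 3\<close> with \<open>x\<close>, hence have inner product \<open>- \<parallel>x\<parallel>\<^sup>2 / 2\<close> with it. The first product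
  gives comonotonicity exactly when \<open>\<rho> \<ge> 1 / (2 L)\<close>. Together they give
  \<open>x \<bullet> F (x - \<gamma>\<^sub>1 *\<^sub>R F x) = - (L / 2) (1 - \<gamma>\<^sub>1 L) \<parallel>x\<parallel>\<^sup>2\<close>, which is nonpositive exactly when
  \<open>\<gamma>\<^sub>1 \<le> 1 / L\<close> or \<open>x = 0\<close>.\<close>

text \<open>Moving from \<open>x\<close> in a direction that makes a nonacute angle with \<open>- x\<close> does not
  bring the point closer to the origin; induction carries this along the iteration.\<close>

lemma extragradient_norm_ge_initial:
  fixes F :: "'a::euclidean_space \<Rightarrow> 'a"
  assumes "\<gamma>\<^sub>2 \<ge> 0" and outward: "\<And>x. x \<bullet> F (x - \<gamma>\<^sub>1 *\<^sub>R F x) \<le> 0"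
  shows "norm (extragradient \<gamma>\<^sub>1 \<gamma>\<^sub>2 F x0 k) \<ge> norm x0"
proof (induction k)
  case 0
  show ?case by simp
next
  case (Suc k)
  define x where "x = extragradient \<gamma>\<^sub>1 \<gamma>\<^sub>2 F x0 k"
  define d where "d = F (x - \<gamma>\<^sub>1 *\<^sub>R F x)"
  have "\<gamma>\<^sub>2 * (x \<bullet> d) \<le> 0"
    using outward[of x] \<open>\<gamma>\<^sub>2 \<ge> 0\<close> by (simp add: d_def mult_nonneg_nonpos)
  moreover have "(norm (x - \<gamma>\<^sub>2 *\<^sub>R d))\<^sup>2 =
      (norm x)\<^sup>2 - 2 * (\<gamma>\<^sub>2 * (x \<bullet> d)) + (norm (\<gamma>\<^sub>2 *\<^sub>R d))\<^sup>2"
    unfolding power2_norm_eq_inner by (simp add: algebra_simps inner_commute)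
  moreover have "(norm (\<gamma>\<^sub>2 *\<^sub>R d))\<^sup>2 \<ge> 0" by simp
  ultimately have "(norm x)\<^sup>2 \<le> (norm (x - \<gamma>\<^sub>2 *\<^sub>R d))\<^sup>2" by linarith
  then have "norm x \<le> norm (x - \<gamma>\<^sub>2 *\<^sub>R d)"
    by (rule power2_le_imp_le) simp
  with Suc show ?case by (simp add: x_def d_def Let_def)
qed

lemma scaled_isometry_counterexample:
  fixes F :: "'a::euclidean_space \<Rightarrow> 'a"
  assumes "linear F" and "L > 0" and "\<gamma>\<^sub>2 \<ge> 0"
    and norm_F: "\<And>x. norm (F x) = L * norm x"
    and comonotone: "\<And>x. F x \<bullet> x \<ge> - \<rho> * (L * norm x)\<^sup>2"
    and outward: "\<And>x. x \<bullet> F (x - \<gamma>\<^sub>1 *\<^sub>R F x) \<le> 0"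
  shows "eg_counterexample L \<rho> \<gamma>\<^sub>1 \<gamma>\<^sub>2 F"
proof -
  have diff: "F x - F y = F (x - y)" for x y
    using \<open>linear F\<close> by (simp add: linear_diff)
  have "L-lipschitz_on UNIV F"
    using \<open>L > 0\<close> by (intro lipschitz_onI) (simp_all add: dist_norm diff norm_F)
  moreover have "negative_comonotone \<rho> F"
    unfolding negative_comonotone_def diff norm_F using comonotone by blast
  moreover have "F 0 = 0" using \<open>linear F\<close> by (rule linear_0)
  moreover have "extragradient_not_nec_convergent \<gamma>\<^sub>1 \<gamma>\<^sub>2 F"
  proof -
    obtain b :: 'a where "b \<in> Basis" using nonempty_Basis by blast
    then have "norm b = 1" by simp
    have "\<not> extragradient \<gamma>\<^sub>1 \<gamma>\<^sub>2 F b \<longlonglongrightarrow> z" if "F z = 0" for z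
    proof
      assume "extragradient \<gamma>\<^sub>1 \<gamma>\<^sub>2 F b \<longlonglongrightarrow> z"
      then have "(\<lambda>k. norm (extragradient \<gamma>\<^sub>1 \<gamma>\<^sub>2 F b k)) \<longlonglongrightarrow> norm z"
        by (rule tendsto_norm)
      moreover have "norm (extragradient \<gamma>\<^sub>1 \<gamma>\<^sub>2 F b k) \<ge> norm b" for k
        using \<open>\<gamma>\<^sub>2 \<ge> 0\<close> outward by (rule extragradient_norm_ge_initial)
      ultimately have "norm b \<le> norm z"
        by (intro LIMSEQ_le_const) auto
      moreover have "norm z = 0"
        using norm_F[of z] that \<open>L > 0\<close> by simp
      ultimately show False using \<open>norm b = 1\<close> by simp
    qed
    then show ?thesis unfolding extragradient_not_nec_convergent_def by blast
  qed
  ultimately show ?thesis unfolding eg_counterexample_def by blast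
qed

lemma scaling_counterexample:
  fixes L \<rho> \<gamma>\<^sub>1 \<gamma>\<^sub>2 :: real
  assumes "L > 0" and "\<rho> \<ge> 0" and "\<gamma>\<^sub>1 \<ge> 1 / L" and "\<gamma>\<^sub>2 \<ge> 0"
  shows "eg_counterexample L \<rho> \<gamma>\<^sub>1 \<gamma>\<^sub>2 (\<lambda>x :: 'a::euclidean_space. L *\<^sub>R x)"
proof (rule scaled_isometry_counterexample)
  show "linear (\<lambda>x :: 'a. L *\<^sub>R x)" by (rule linear_scaleR)
next
  fix x :: 'a
  show "norm (L *\<^sub>R x) = L * norm x" using \<open>L > 0\<close> by simp
  have "- \<rho> * (L * norm x)\<^sup>2 \<le> 0" using \<open>\<rho> \<ge> 0\<close> by simp
  also have "0 \<le> (L *\<^sub>R x) \<bullet> x" using \<open>L > 0\<close> by simp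
  finally show "(L *\<^sub>R x) \<bullet> x \<ge> - \<rho> * (L * norm x)\<^sup>2" .
  have "1 - \<gamma>\<^sub>1 * L \<le> 0" using \<open>\<gamma>\<^sub>1 \<ge> 1 / L\<close> \<open>L > 0\<close> by (simp add: field_simps)
  then have "(1 - \<gamma>\<^sub>1 * L) * (L * (x \<bullet> x)) \<le> 0"
    using \<open>L > 0\<close> by (intro mult_nonpos_nonneg) simp_all
  then show "x \<bullet> (L *\<^sub>R (x - \<gamma>\<^sub>1 *\<^sub>R L *\<^sub>R x)) \<le> 0"
    by (simp add: algebra_simps)
qed (use assms in simp_all)

lemma rotation2_mult_vec:
  "rotation2 \<theta> *v x = vector [cos \<theta> * x $ 1 - sin \<theta> * x $ 2, sin \<theta> * x $ 1 + cos \<theta> * x $ 2]"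
  by (simp add: rotation2_def vec_eq_iff forall_2 matrix_vector_mult_def sum_2)

lemma inner_rotation2: "x \<bullet> (rotation2 \<theta> *v x) = cos \<theta> * (norm x)\<^sup>2"
  unfolding power2_norm_eq_inner
  by (simp add: rotation2_mult_vec inner_vec_def sum_2 algebra_simps)

lemma norm_rotation2: "norm (rotation2 \<theta> *v x) = norm x"
proof -
  have "(norm (rotation2 \<theta> *v x))\<^sup>2 = ((sin \<theta>)\<^sup>2 + (cos \<theta>)\<^sup>2) * (norm x)\<^sup>2"
    unfolding power2_norm_eq_inner rotation2_mult_vec inner_vec_def sum_2 inner_real_def vector_2
    by algebra
  then show ?thesis by simp
qed

lemma rotation2_add: "rotation2 \<alpha> *v (rotation2 \<beta> *v x) = rotation2 (\<alpha> + \<beta>) *v x"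
  by (simp add: rotation2_mult_vec vec_eq_iff forall_2 cos_add sin_add algebra_simps)

lemma rotation_counterexample:
  fixes L \<rho> \<gamma>\<^sub>1 \<gamma>\<^sub>2 :: real
  assumes "L > 0" and "\<rho> \<ge> 1 / (2 * L)" and "\<gamma>\<^sub>1 \<le> 1 / L" and "\<gamma>\<^sub>2 \<ge> 0"
  shows "eg_counterexample L \<rho> \<gamma>\<^sub>1 \<gamma>\<^sub>2
    (\<lambda>x :: real ^ 2. L *\<^sub>R (rotation2 (2 * pi / 3) *v x))"
proof (rule scaled_isometry_counterexample)
  let ?R = "\<lambda>x. rotation2 (2 * pi / 3) *v x"
  show "linear (\<lambda>x. L *\<^sub>R ?R x)"
    by (intro linear_compose_scale_right matrix_vector_mul_linear)
  fix x :: "real ^ 2"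
  have cos_third: "cos (2 * pi / 3) = - 1 / 2"
    using cos_120 by simp
  then have inner_R: "x \<bullet> ?R x = - (norm x)\<^sup>2 / 2"
    by (simp add: inner_rotation2)
  have "cos (2 * pi / 3 + 2 * pi / 3) = - 1 / 2"
    unfolding mult_2[symmetric] cos_double_cos cos_third by (simp add: power2_eq_square)
  then have inner_RR: "x \<bullet> ?R (?R x) = - (norm x)\<^sup>2 / 2"
    by (simp only: rotation2_add inner_rotation2)
  show "norm (L *\<^sub>R ?R x) = L * norm x"
    using \<open>L > 0\<close> by (simp add: norm_rotation2)
  have "1 / 2 \<le> \<rho> * L" using assms(1,2) by (simp add: field_simps)
  then have "1 / 2 * (L * (norm x)\<^sup>2) \<le> \<rho> * L * (L * (norm x)\<^sup>2)"
    using \<open>L > 0\<close> by (intro mult_right_mono) simp_all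
  then show "(L *\<^sub>R ?R x) \<bullet> x \<ge> - \<rho> * (L * norm x)\<^sup>2"
    unfolding inner_commute[of _ x] inner_scaleR_right inner_R
    by (simp add: power2_eq_square algebra_simps)
  have "x \<bullet> (L *\<^sub>R ?R (x - \<gamma>\<^sub>1 *\<^sub>R L *\<^sub>R ?R x)) = L * (x \<bullet> ?R x) - \<gamma>\<^sub>1 * L\<^sup>2 * (x \<bullet> ?R (?R x))"
    unfolding matrix_vector_mult_diff_distrib matrix_vector_mult_scaleR inner_scaleR_right
      inner_diff_right
    by (simp add: power2_eq_square right_diff_distrib mult_ac)
  also have "\<dots> = (\<gamma>\<^sub>1 * L - 1) * (L * (norm x)\<^sup>2 / 2)"
    unfolding inner_R inner_RR by (simp add: power2_eq_square algebra_simps)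
  also have "\<dots> \<le> 0"
  proof (rule mult_nonpos_nonneg)
    show "\<gamma>\<^sub>1 * L - 1 \<le> 0" using \<open>\<gamma>\<^sub>1 \<le> 1 / L\<close> \<open>L > 0\<close> by (simp add: field_simps)
  qed (use \<open>L > 0\<close> in simp)
  finally show "x \<bullet> (L *\<^sub>R ?R (x - \<gamma>\<^sub>1 *\<^sub>R L *\<^sub>R ?R x)) \<le> 0" .
qed (use assms in simp_all)

theorem theorem4p3:
  fixes L \<rho> \<gamma>\<^sub>1 \<gamma>\<^sub>2 :: real
  assumes "L > 0" and "\<rho> \<ge> 1 / (2 * L)" and "\<gamma>\<^sub>1 > 0" and "\<gamma>\<^sub>2 > 0"
  shows "(\<exists>F :: real ^ 2 \<Rightarrow> real ^ 2. eg_counterexample L \<rho> \<gamma>\<^sub>1 \<gamma>\<^sub>2 F) \<and>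
    (\<gamma>\<^sub>1 > 1 / L \<longrightarrow>
       eg_counterexample L \<rho> \<gamma>\<^sub>1 \<gamma>\<^sub>2 (\<lambda>x :: real ^ 'n. L *\<^sub>R x)) \<and>
    (\<gamma>\<^sub>1 \<le> 1 / L \<longrightarrow>
       eg_counterexample L \<rho> \<gamma>\<^sub>1 \<gamma>\<^sub>2
         (\<lambda>x :: real ^ 2. L *\<^sub>R (rotation2 (2 * pi / 3) *v x)))"
proof -
  have "0 < 1 / (2 * L)" using \<open>L > 0\<close> by simp
  then have "\<rho> \<ge> 0" using assms(2) by linarith
  then have scaling: "eg_counterexample L \<rho> \<gamma>\<^sub>1 \<gamma>\<^sub>2 (\<lambda>x :: 'a::euclidean_space. L *\<^sub>R x)"
    if "\<gamma>\<^sub>1 > 1 / L"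
    using that assms by (intro scaling_counterexample) simp_all
  have rotation: "eg_counterexample L \<rho> \<gamma>\<^sub>1 \<gamma>\<^sub>2
      (\<lambda>x :: real ^ 2. L *\<^sub>R (rotation2 (2 * pi / 3) *v x))" if "\<gamma>\<^sub>1 \<le> 1 / L"
    using that assms by (intro rotation_counterexample) simp_all
  show ?thesis
    using scaling rotation by (meson not_le)
qed

end
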